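(* Let $\kappa$ be an inaccessible cardinal. If $\kappa$ is not first-order sententially categorical, then every first-order sentence true in $V_\kappa$ is also true in $V_\delta$ for some inaccessible cardinal $\delta<\kappa$. Likewise, if $\kappa$ is not second-order sententially categorical, then every second-order sentence true in $V_\kappa$ is also true in $V_\delta$ for some inaccessible cardinal $\delta<\kappa$.
   Context: $V_\kappa$ denotes the rank-initial segment of the cumulative hierarchy; second-order sentences in $V_\kappa$ have second-order quantifiers ranging over all subsets of $V_\kappa$. A cardinal $\kappa$ is first-order (resp. second-order) sententially categorical if there is a first-order (resp. second-order) sentence $\sigma$ such that $\kappa$ is inaccessible, $V_\kappa\models\sigma$, and $V_\lambda\not\models\sigma$ for every inaccessible $\lambda\neq\kappa$. *)

theory Defs
  imports Main "HOL-Library.Equipollence" "HOL-Library.Countable_Set"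
begin

text \<open>
  The axioms of ZFC for the universe of sets, where \<open>elts x\<close> is the extension of the set \<open>x\<close>.
  Classes and class functions are arbitrary HOL predicates and functions, so every subset of
  \<open>elts x\<close>, and every function on it, is represented by a set. The axiom of choice therefore follows
  from choice in HOL, and internal notions (equipollence, countability, the natural numbers)
  agree with those of HOL. Foundation is stated as \<open>\<in>\<close>-induction.
\<close>

class zfc =
  fixes elts :: "'a \<Rightarrow> 'a set"
  assumes extensionality: "elts x = elts y \<Longrightarrow> x = y"
    and foundation: "wf {(x, y). x \<in> elts y}"
    and pairing: "\<exists>z. elts z = {x, y}"
    and union: "\<exists>z. elts z = (\<Union>y\<in>elts x. elts y)"
    and powerset: "\<exists>z. elts z = {y. elts y \<subseteq> elts x}"
    and infinity: "\<exists>w. (\<exists>z\<in>elts w. elts z = {}) \<and>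
                       (\<forall>x\<in>elts w. \<exists>s\<in>elts w. elts s = insert x (elts x))"
    and separation: "\<exists>z. elts z = {y \<in> elts x. P y}"
    and replacement: "\<exists>z. elts z = f ` elts x"

definition transitive_set :: "'v::zfc \<Rightarrow> bool" where
  "transitive_set x \<longleftrightarrow> (\<forall>y\<in>elts x. elts y \<subseteq> elts x)"

definition ordinal :: "'v::zfc \<Rightarrow> bool" where
  "ordinal \<alpha> \<longleftrightarrow> transitive_set \<alpha> \<and> (\<forall>\<beta>\<in>elts \<alpha>. transitive_set \<beta>)"

definition cardinal :: "'v::zfc \<Rightarrow> bool" where
  "cardinal \<kappa> \<longleftrightarrow> ordinal \<kappa> \<and> (\<forall>\<alpha>\<in>elts \<kappa>. \<not> elts \<alpha> \<approx> elts \<kappa>)"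

definition regular :: "'v::zfc \<Rightarrow> bool" where
  "regular \<kappa> \<longleftrightarrow> cardinal \<kappa> \<and> infinite (elts \<kappa>) \<and>
     (\<forall>X \<subseteq> elts \<kappa>. (\<forall>\<alpha>\<in>elts \<kappa>. \<exists>\<beta>\<in>X. \<alpha> = \<beta> \<or> \<alpha> \<in> elts \<beta>) \<longrightarrow> X \<approx> elts \<kappa>)"

definition strong_limit :: "'v::zfc \<Rightarrow> bool" where
  "strong_limit \<kappa> \<longleftrightarrow> cardinal \<kappa> \<and> (\<forall>\<alpha>\<in>elts \<kappa>. Pow (elts \<alpha>) \<prec> elts \<kappa>)"

definition inaccessible :: "'v::zfc \<Rightarrow> bool" where
  "inaccessible \<kappa> \<longleftrightarrow> uncountable (elts \<kappa>) \<and> regular \<kappa> \<and> strong_limit \<kappa>"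

text \<open>
  The cumulative hierarchy, with \<open>Vset \<alpha>\<close> given as the HOL set of its elements; the successor and
  limit clauses are combined into the single recursion equation proved below.
\<close>

definition Vset :: "'v::zfc \<Rightarrow> 'v set" where
  "Vset = wfrec {(x, y). x \<in> elts y} (\<lambda>V \<alpha>. \<Union>\<beta>\<in>elts \<alpha>. {x. elts x \<subseteq> V \<beta>})"

lemma Vset_unfold: "Vset \<alpha> = (\<Union>\<beta>\<in>elts \<alpha>. {x. elts x \<subseteq> Vset \<beta>})"
  unfolding Vset_def by (subst wfrec[OF foundation]) (simp add: cut_apply)

text \<open>
  Formulas of the second-order language of set theory, with separate name spaces for first-order
  and second-order (set) variables. \<open>In i j\<close> says that the value of the first-order variable \<open>i\<close>
  belongs to the value of the second-order variable \<open>j\<close>.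
\<close>

datatype fm =
    Mem nat nat
  | Eq nat nat
  | In nat nat
  | Neg fm
  | Conj fm fm
  | All nat fm
  | AllSet nat fm

fun free_vars :: "fm \<Rightarrow> nat set" where
  "free_vars (Mem i j) = {i, j}"
| "free_vars (Eq i j) = {i, j}"
| "free_vars (In i j) = {i}"
| "free_vars (Neg \<phi>) = free_vars \<phi>"
| "free_vars (Conj \<phi> \<psi>) = free_vars \<phi> \<union> free_vars \<psi>"
| "free_vars (All i \<phi>) = free_vars \<phi> - {i}"
| "free_vars (AllSet j \<phi>) = free_vars \<phi>"

fun free_set_vars :: "fm \<Rightarrow> nat set" where
  "free_set_vars (Mem i j) = {}"
| "free_set_vars (Eq i j) = {}"
| "free_set_vars (In i j) = {j}"
| "free_set_vars (Neg \<phi>) = free_set_vars \<phi>"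
| "free_set_vars (Conj \<phi> \<psi>) = free_set_vars \<phi> \<union> free_set_vars \<psi>"
| "free_set_vars (All i \<phi>) = free_set_vars \<phi>"
| "free_set_vars (AllSet j \<phi>) = free_set_vars \<phi> - {j}"

fun first_order :: "fm \<Rightarrow> bool" where
  "first_order (Mem i j) = True"
| "first_order (Eq i j) = True"
| "first_order (In i j) = False"
| "first_order (Neg \<phi>) = first_order \<phi>"
| "first_order (Conj \<phi> \<psi>) = (first_order \<phi> \<and> first_order \<psi>)"
| "first_order (All i \<phi>) = first_order \<phi>"
| "first_order (AllSet j \<phi>) = False"

definition second_order_sentence :: "fm \<Rightarrow> bool" where
  "second_order_sentence \<sigma> \<longleftrightarrow> free_vars \<sigma> = {} \<and> free_set_vars \<sigma> = {}"

definition first_order_sentence :: "fm \<Rightarrow> bool" where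
  "first_order_sentence \<sigma> \<longleftrightarrow> first_order \<sigma> \<and> free_vars \<sigma> = {}"

fun sat :: "'v::zfc set \<Rightarrow> (nat \<Rightarrow> 'v) \<Rightarrow> (nat \<Rightarrow> 'v set) \<Rightarrow> fm \<Rightarrow> bool" where
  "sat M e E (Mem i j) \<longleftrightarrow> e i \<in> elts (e j)"
| "sat M e E (Eq i j) \<longleftrightarrow> e i = e j"
| "sat M e E (In i j) \<longleftrightarrow> e i \<in> E j"
| "sat M e E (Neg \<phi>) \<longleftrightarrow> \<not> sat M e E \<phi>"
| "sat M e E (Conj \<phi> \<psi>) \<longleftrightarrow> sat M e E \<phi> \<and> sat M e E \<psi>"
| "sat M e E (All i \<phi>) \<longleftrightarrow> (\<forall>x\<in>M. sat M (e(i := x)) E \<phi>)"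
| "sat M e E (AllSet j \<phi>) \<longleftrightarrow> (\<forall>X. X \<subseteq> M \<longrightarrow> sat M e (E(j := X)) \<phi>)"

definition models :: "'v::zfc set \<Rightarrow> fm \<Rightarrow> bool" (infix "\<Turnstile>" 50) where
  "M \<Turnstile> \<sigma> \<longleftrightarrow> (\<forall>e E. range e \<subseteq> M \<and> (\<forall>j. E j \<subseteq> M) \<longrightarrow> sat M e E \<sigma>)"

definition first_order_sententially_categorical :: "'v::zfc \<Rightarrow> bool" where
  "first_order_sententially_categorical \<kappa> \<longleftrightarrow>
     (\<exists>\<sigma>. first_order_sentence \<sigma> \<and> inaccessible \<kappa> \<and> Vset \<kappa> \<Turnstile> \<sigma> \<and>
        (\<forall>\<mu>. inaccessible \<mu> \<and> \<mu> \<noteq> \<kappa> \<longrightarrow> \<not> Vset \<mu> \<Turnstile> \<sigma>))"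

definition second_order_sententially_categorical :: "'v::zfc \<Rightarrow> bool" where
  "second_order_sententially_categorical \<kappa> \<longleftrightarrow>
     (\<exists>\<sigma>. second_order_sentence \<sigma> \<and> inaccessible \<kappa> \<and> Vset \<kappa> \<Turnstile> \<sigma> \<and>
        (\<forall>\<mu>. inaccessible \<mu> \<and> \<mu> \<noteq> \<kappa> \<longrightarrow> \<not> Vset \<mu> \<Turnstile> \<sigma>))"

end

theory Submission
  imports Defs
begin

text \<open>
  If \<open>\<sigma>\<close> holds in \<open>V\<^sub>\<kappa>\<close> but in no \<open>V\<^sub>\<delta>\<close> with \<open>\<delta> < \<kappa>\<close> inaccessible, then \<open>\<kappa>\<close> is the only
  inaccessible cardinal at which ``\<open>\<sigma>\<close>, and \<open>V\<^sub>\<delta>\<close> refutes \<open>\<sigma>\<close> for every inaccessible \<open>\<delta>\<close>'' holds: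
  below \<open>\<kappa>\<close> the first conjunct fails, and above \<open>\<kappa>\<close> the second fails at \<open>\<delta> = \<kappa>\<close>. This sentence is
  available because the class of all \<open>V\<^sub>\<delta>\<close>, \<open>\<delta>\<close> inaccessible, is definable by a first-order formula
  that every \<open>V\<^sub>\<mu>\<close>, \<open>\<mu>\<close> inaccessible, evaluates correctly (Zermelo's characterization by closure
  properties), and because satisfaction of a fixed sentence in \<open>V\<^sub>\<delta>\<close>, even a second-order one, is a
  first-order property of \<open>V\<^sub>\<delta>\<close>: all subsets of \<open>V\<^sub>\<delta>\<close> are elements of \<open>V\<^sub>\<mu>\<close>.
\<close>

unbundle cardinal_syntax

section \<open>Ordinals as well-orders\<close>

lemma mem_irrefl: "x \<notin> elts (x::'v::zfc)"
  using wf_not_refl[OF foundation, of x] by simp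

lemma mem_asym: "x \<in> elts y \<Longrightarrow> y \<notin> elts (x::'v::zfc)"
  using wf_not_sym[OF foundation, of x y] by simp

lemma mem_induct [case_names mem]:
  fixes x :: "'v::zfc"
  assumes "\<And>x. (\<And>y. y \<in> elts x \<Longrightarrow> P y) \<Longrightarrow> P x"
  shows "P x"
  by (rule wf_induct_rule[OF foundation]) (simp add: assms)

lemma mem_minimal:
  fixes A :: "'v::zfc set"
  assumes "a \<in> A"
  obtains m where "m \<in> A" "\<And>y. y \<in> elts m \<Longrightarrow> y \<notin> A"
  by (rule wfE_min[OF foundation assms]) (simp add: that)

lemma subset_is_set:
  assumes "X \<subseteq> elts (x::'v::zfc)"
  obtains z where "elts z = X"
proof -
  obtain z where "elts z = {y \<in> elts x. y \<in> X}" 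
    using separation[of x "\<lambda>y. y \<in> X"] by blast
  with assms have "elts z = X" by blast
  then show thesis by (rule that)
qed

lemma ordinal_mem: "ordinal \<alpha> \<Longrightarrow> \<beta> \<in> elts \<alpha> \<Longrightarrow> ordinal \<beta>"
  unfolding ordinal_def by (meson subsetD transitive_set_def)

lemma ordinal_mem_subset: "ordinal \<alpha> \<Longrightarrow> \<beta> \<in> elts \<alpha> \<Longrightarrow> elts \<beta> \<subseteq> elts \<alpha>"
  by (auto simp: ordinal_def transitive_set_def)

lemma ordinalI: "(\<And>\<beta>. \<beta> \<in> elts \<alpha> \<Longrightarrow> ordinal \<beta> \<and> elts \<beta> \<subseteq> elts \<alpha>) \<Longrightarrow> ordinal \<alpha>"
  by (auto simp: ordinal_def transitive_set_def)

text \<open>Double membership induction: if \<alpha> and \<beta> were incomparable, the induction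
  hypotheses and transitivity would put every element of each into the other, and extensionality
  would make them equal.\<close>

lemma ordinal_linear:
  assumes "ordinal \<alpha>" "ordinal \<beta>"
  shows "\<alpha> \<in> elts \<beta> \<or> \<alpha> = \<beta> \<or> \<beta> \<in> elts \<alpha>"
  using assms
proof (induction \<alpha> arbitrary: \<beta> rule: mem_induct)
  case (mem \<alpha>)
  note outer = mem
  from outer(3) show ?case
  proof (induction \<beta> rule: mem_induct)
    case (mem \<beta>)
    show ?case
    proof (rule ccontr)
      assume not: "\<not> ?case"
      have "elts \<alpha> = elts \<beta>"
      proof
        show "elts \<alpha> \<subseteq> elts \<beta>"
          using outer(1,2) mem(2) not ordinal_mem ordinal_mem_subset by blast
        show "elts \<beta> \<subseteq> elts \<alpha>"
          using mem outer(2) not ordinal_mem ordinal_mem_subset by blast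
      qed
      with not extensionality show False by blast
    qed
  qed
qed

text \<open>Reflexive, as well-orders in the library are. It makes the theory of \<open><o\<close>
  and \<open>=o\<close> applicable to ordinals, whose proper initial segments are their own
  elements.\<close>

definition mem_order :: "'v::zfc \<Rightarrow> 'v rel" where
  "mem_order \<alpha> = {(\<xi>, \<eta>). \<xi> \<in> elts \<alpha> \<and> \<eta> \<in> elts \<alpha> \<and> (\<xi> = \<eta> \<or> \<xi> \<in> elts \<eta>)}"

lemma Field_mem_order [simp]: "Field (mem_order \<alpha>) = elts \<alpha>"
  by (auto simp: Field_def mem_order_def)

lemma Well_order_mem_order:
  assumes "ordinal \<alpha>"
  shows "Well_order (mem_order \<alpha>)"
proof -
  have "refl_on (elts \<alpha>) (mem_order \<alpha>)"
    by (auto simp: refl_on_def mem_order_def)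
  moreover have "mem_order \<alpha> \<subseteq> elts \<alpha> \<times> elts \<alpha>"
    by (auto simp: mem_order_def)
  moreover have "trans (mem_order \<alpha>)"
    using ordinal_mem[OF assms] ordinal_mem_subset
    by (fastforce simp: trans_def mem_order_def)
  moreover have "antisym (mem_order \<alpha>)"
    using mem_asym by (auto simp: antisym_def mem_order_def)
  moreover have "total_on (elts \<alpha>) (mem_order \<alpha>)"
    using ordinal_linear ordinal_mem[OF assms] by (fastforce simp: total_on_def mem_order_def)
  moreover have "wf (mem_order \<alpha> - Id)"
    by (rule wf_subset[OF foundation]) (auto simp: mem_order_def)
  ultimately show ?thesis
    by (simp add: well_order_on_def linear_order_on_def partial_order_on_def preorder_on_def)
qed

lemma underS_mem_order:
  assumes "ordinal \<alpha>" "\<beta> \<in> elts \<alpha>"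
  shows "underS (mem_order \<alpha>) \<beta> = elts \<beta>"
  using ordinal_mem_subset[OF assms] assms mem_irrefl by (auto simp: underS_def mem_order_def)

lemma ordLess_mem_orderE:
  assumes "ordinal \<alpha>" "|X| <o mem_order \<alpha>"
  obtains \<beta> where "\<beta> \<in> elts \<alpha>" "X \<approx> elts \<beta>"
proof -
  obtain \<beta> where \<beta>: "\<beta> \<in> elts \<alpha>" "|X| =o Restr (mem_order \<alpha>) (underS (mem_order \<alpha>) \<beta>)"
    using ordLess_iff_ordIso_Restr[OF Well_order_mem_order[OF assms(1)] card_of_Well_order, of X] assms(2) by auto
  have "Field (Restr (mem_order \<alpha>) (elts \<beta>)) = elts \<beta>"
    using ordinal_mem_subset[OF assms(1) \<beta>(1)] by (auto simp: Field_def mem_order_def)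
  then have "|X| =o |elts \<beta>|"
    using \<beta>(2) underS_mem_order[OF assms(1) \<beta>(1)] card_of_Field_ordIso
    by (metis Card_order_ordIso2 card_of_Card_order ordIso_symmetric ordIso_transitive)
  with \<beta>(1) that show thesis
    by (simp add: eqpoll_iff_card_of_ordIso)
qed

section \<open>Comparing sizes by cardinal arithmetic on well-orders\<close>

lemma lesspoll_iff_ordLess: "A \<prec> B \<longleftrightarrow> |A| <o |B|"
proof -
  have le: "X \<lesssim> Y \<longleftrightarrow> |X| \<le>o |Y|" for X :: "'x set" and Y :: "'y set"
    by (simp add: lepoll_def card_of_ordLeq)
  show ?thesis
    unfolding lesspoll_def le eqpoll_iff_card_of_ordIso
    using ordLeq_iff_ordLess_or_ordIso not_ordLess_ordIso by blast
qed

lemma not_lepoll_iff_lesspoll: "\<not> A \<lesssim> B \<longleftrightarrow> B \<prec> A"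
  unfolding lesspoll_iff_ordLess lepoll_def card_of_ordLeq
  by (rule not_ordLeq_iff_ordLess[OF card_of_Well_order card_of_Well_order])

text \<open>\<open>|elts \<kappa>|\<close> is a least well-order on \<open>elts \<kappa>\<close>;
  were it strictly shorter than \<open>mem_order \<kappa>\<close>, then \<kappa> would be
  equipollent to one of its own elements.\<close>

lemma cardinal_ordIso:
  assumes "cardinal \<kappa>"
  shows "mem_order \<kappa> =o |elts \<kappa>|"
proof -
  have ord: "ordinal \<kappa>" using assms by (simp add: cardinal_def)
  note wo = Well_order_mem_order[OF ord]
  have "\<not> |elts \<kappa>| <o mem_order \<kappa>"
    using ordLess_mem_orderE[OF ord] assms eqpoll_sym unfolding cardinal_def by metis
  then have "mem_order \<kappa> \<le>o |elts \<kappa>|"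
    using wo card_of_Well_order not_ordLess_iff_ordLeq by blast
  moreover have "|elts \<kappa>| \<le>o mem_order \<kappa>"
    using card_of_least[OF wo[unfolded Field_mem_order]] .
  ultimately show ?thesis by (simp add: ordIso_iff_ordLeq)
qed

lemma lesspoll_ordinalE:
  assumes "ordinal \<alpha>" "X \<prec> elts \<alpha>"
  obtains \<beta> where "\<beta> \<in> elts \<alpha>" "X \<approx> elts \<beta>"
proof -
  have "|elts \<alpha>| \<le>o mem_order \<alpha>"
    using card_of_least[OF Well_order_mem_order[OF assms(1), unfolded Field_mem_order]] .
  with assms(2) have "|X| <o mem_order \<alpha>"
    unfolding lesspoll_iff_ordLess by (rule ordLess_ordLeq_trans)
  with ordLess_mem_orderE[OF assms(1)] that show thesis by blast
qed

lemma cardinal_mem_lesspoll: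
  assumes "cardinal \<kappa>" "\<alpha> \<in> elts \<kappa>"
  shows "elts \<alpha> \<prec> elts \<kappa>"
  using assms ordinal_mem_subset by (auto simp: cardinal_def lesspoll_def intro!: subset_imp_lepoll)

text \<open>Regularity is carried over to the library's \<open>regularCard\<close>, for which
  stability under small unions is known.\<close>

lemma regular_UN_lesspoll:
  fixes A :: "'v::zfc set" and F :: "'v \<Rightarrow> 'v set"
  assumes "regular \<kappa>" "A \<prec> elts \<kappa>" "\<And>a. a \<in> A \<Longrightarrow> F a \<prec> elts \<kappa>"
  shows "(\<Union>a\<in>A. F a) \<prec> elts \<kappa>"
proof -
  have card: "cardinal \<kappa>" using assms(1) by (simp add: regular_def)
  note iso = cardinal_ordIso[OF card]
  have co: "Card_order (mem_order \<kappa>)"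
    using iso card_of_Card_order Card_order_ordIso by blast
  have "regularCard (mem_order \<kappa>)"
    unfolding regularCard_def cofinal_def
  proof (intro allI impI, elim conjE)
    fix K assume K: "K \<subseteq> Field (mem_order \<kappa>)"
      and cof: "\<forall>a\<in>Field (mem_order \<kappa>). \<exists>b\<in>K. a \<noteq> b \<and> (a, b) \<in> mem_order \<kappa>"
    \<comment> \<open>The library's cofinality asks for strict upper bounds in \<open>K\<close>,
      which also serve as the non-strict ones in \<open>regular\<close>.\<close>
    have "\<forall>\<alpha>\<in>elts \<kappa>. \<exists>\<beta>\<in>K. \<alpha> = \<beta> \<or> \<alpha> \<in> elts \<beta>"
    proof
      fix \<alpha> assume "\<alpha> \<in> elts \<kappa>"
      with cof obtain \<beta> where "\<beta> \<in> K" "(\<alpha>, \<beta>) \<in> mem_order \<kappa>" by fastforce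
      then show "\<exists>\<beta>\<in>K. \<alpha> = \<beta> \<or> \<alpha> \<in> elts \<beta>" by (auto simp: mem_order_def)
    qed
    with K assms(1) have "K \<approx> elts \<kappa>" by (simp add: regular_def)
    then show "|K| =o mem_order \<kappa>"
      using iso eqpoll_iff_card_of_ordIso ordIso_symmetric ordIso_transitive by blast
  qed
  then have "stable (mem_order \<kappa>)"
    using regularCard_stable[OF co] assms(1) by (simp add: regular_def)
  then have "stable |elts \<kappa>|"
    using stable_ordIso1[OF _ ordIso_symmetric[OF iso]] by blast
  then show ?thesis
    using assms(2,3) stable_UNION unfolding lesspoll_iff_ordLess by blast
qed

text \<open>\<open>strong_limit\<close> speaks only of elements of \<kappa>; a smaller set is
  equipollent to one of them, and the bijection lifts to power sets.\<close>

lemma inaccessible_Pow_lesspoll: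
  assumes "inaccessible \<kappa>" "X \<prec> elts \<kappa>"
  shows "Pow X \<prec> elts \<kappa>"
proof -
  have sl: "strong_limit \<kappa>" and ord: "ordinal \<kappa>"
    using assms(1) by (auto simp: inaccessible_def regular_def cardinal_def)
  obtain \<beta> where \<beta>: "\<beta> \<in> elts \<kappa>" "X \<approx> elts \<beta>"
    using lesspoll_ordinalE[OF ord assms(2)] .
  then obtain f where "bij_betw f X (elts \<beta>)" by (auto simp: eqpoll_def)
  then have "Pow X \<approx> Pow (elts \<beta>)"
    using bij_betw_Pow unfolding eqpoll_def by blast
  moreover have "Pow (elts \<beta>) \<prec> elts \<kappa>" using sl \<beta>(1) by (simp add: strong_limit_def)
  ultimately show ?thesis by (rule eq_lesspoll_trans)
qed

text \<open>Cofinal subsets of a regular cardinal have full size, so a smaller subset fails to reach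
  some \<gamma>; by linearity all of it lies below that \<gamma>.\<close>

lemma inaccessible_bounded:
  assumes "inaccessible \<kappa>" "X \<subseteq> elts \<kappa>" "X \<prec> elts \<kappa>"
  obtains \<gamma> where "\<gamma> \<in> elts \<kappa>" "X \<subseteq> elts \<gamma>"
proof -
  have reg: "regular \<kappa>" and ord: "ordinal \<kappa>"
    using assms(1) by (auto simp: inaccessible_def regular_def cardinal_def)
  have "\<not> X \<approx> elts \<kappa>" using assms(3) by (simp add: lesspoll_def)
  with reg assms(2) obtain \<gamma> where \<gamma>: "\<gamma> \<in> elts \<kappa>" "\<forall>\<beta>\<in>X. \<not> (\<gamma> = \<beta> \<or> \<gamma> \<in> elts \<beta>)"
    unfolding regular_def by blast
  then have "X \<subseteq> elts \<gamma>"
    using ordinal_linear ordinal_mem[OF ord] assms(2) by blast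
  with \<gamma>(1) that show thesis by blast
qed

section \<open>Inaccessible cardinals and universes\<close>

lemma Vset_iff: "x \<in> Vset \<alpha> \<longleftrightarrow> (\<exists>\<beta>\<in>elts \<alpha>. elts x \<subseteq> Vset \<beta>)"
  by (subst Vset_unfold) blast

lemma Vset_mono: "elts \<beta> \<subseteq> elts \<alpha> \<Longrightarrow> Vset \<beta> \<subseteq> Vset \<alpha>"
  unfolding Vset_unfold[of \<alpha>] Vset_unfold[of \<beta>] by blast

lemma Vset_subset: "ordinal \<alpha> \<Longrightarrow> x \<in> Vset \<alpha> \<Longrightarrow> elts x \<subseteq> Vset \<alpha>"
  using Vset_mono ordinal_mem_subset unfolding Vset_iff[of x] by blast

text \<open>Membership induction: replacement collects the power sets of the earlier levels and
  union joins them.\<close>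

lemma Vset_is_set:
  fixes \<alpha> :: "'v::zfc"
  shows "\<exists>v. elts v = Vset \<alpha>"
proof (induction \<alpha> rule: mem_induct)
  case (mem \<alpha>)
  have "\<exists>p. \<forall>\<beta>\<in>elts \<alpha>. elts (p \<beta>) = {x. elts x \<subseteq> Vset \<beta>}"
  proof (rule bchoice, rule ballI)
    fix \<beta> assume "\<beta> \<in> elts \<alpha>"
    then obtain v where "elts v = Vset \<beta>" using mem by blast
    with powerset[of v] show "\<exists>p. elts p = {x. elts x \<subseteq> Vset \<beta>}" by simp
  qed
  then obtain p where p: "\<And>\<beta>. \<beta> \<in> elts \<alpha> \<Longrightarrow> elts (p \<beta>) = {x. elts x \<subseteq> Vset \<beta>}"
    by blast
  obtain r where "elts r = p ` elts \<alpha>" using replacement[of p \<alpha>] by blast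
  with union[of r] p show ?case by (subst Vset_unfold) auto
qed

text \<open>
  A set is a universe iff it is \<open>Vset \<delta>\<close> for an inaccessible \<open>\<delta>\<close>. Each clause is phrased so that a
  first-order formula without defined terms expresses it; in particular the last one is collection
  for a relation rather than a function, and bounds the values by inclusion, so that it also
  subsumes closure under unions.
\<close>

definition universe :: "'v::zfc set \<Rightarrow> bool" where
  "universe M \<longleftrightarrow>
     (\<forall>x\<in>M. elts x \<subseteq> M) \<and>
     (\<forall>x\<in>M. \<exists>y\<in>M. \<forall>z. elts z \<subseteq> elts x \<longrightarrow> z \<in> elts y) \<and>
     (\<exists>w\<in>M. elts w \<noteq> {} \<and> (\<forall>a\<in>elts w. \<exists>b\<in>elts w. a \<in> elts b)) \<and>
     (\<forall>x\<in>M. \<forall>R. (\<forall>a\<in>elts x. \<exists>b\<in>M. R a b) \<longrightarrow>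
        (\<exists>y\<in>M. \<forall>a\<in>elts x. \<exists>b\<in>M. R a b \<and> elts b \<subseteq> elts y))"

section \<open>Levels at inaccessible cardinals are universes\<close>

lemma inaccessible_ordinal: "inaccessible \<kappa> \<Longrightarrow> ordinal \<kappa>"
  by (simp add: inaccessible_def regular_def cardinal_def)

lemma inaccessible_limit:
  assumes "inaccessible \<kappa>" "\<beta> \<in> elts \<kappa>"
  obtains \<gamma> where "\<gamma> \<in> elts \<kappa>" "\<beta> \<in> elts \<gamma>"
proof -
  have "infinite (elts \<kappa>)" using assms(1) by (simp add: inaccessible_def regular_def)
  then have "{\<beta>} \<prec> elts \<kappa>" using finite_lesspoll_infinite by blast
  then obtain \<gamma> where "\<gamma> \<in> elts \<kappa>" "{\<beta>} \<subseteq> elts \<gamma>"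
    using inaccessible_bounded[OF assms(1), of "{\<beta>}"] assms(2) by blast
  with that show thesis by blast
qed

text \<open>By induction, the strong limit property keeps the power set of each earlier level small,
  and regularity keeps the union of fewer than \<kappa> of them small.\<close>

lemma Vset_lesspoll:
  assumes "inaccessible \<kappa>" "\<beta> \<in> elts \<kappa>"
  shows "Vset \<beta> \<prec> elts \<kappa>"
  using assms(2)
proof (induction \<beta> rule: mem_induct)
  case (mem \<beta>)
  have reg: "regular \<kappa>" and card: "cardinal \<kappa>"
    using assms(1) by (auto simp: inaccessible_def regular_def)
  have "{x. elts x \<subseteq> Vset \<xi>} \<prec> elts \<kappa>" if "\<xi> \<in> elts \<beta>" for \<xi>
  proof -
    have "{x. elts x \<subseteq> Vset \<xi>} \<lesssim> Pow (Vset \<xi>)"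
      unfolding lepoll_def by (rule exI[of _ elts]) (auto simp: inj_on_def intro: extensionality)
    moreover have "Vset \<xi> \<prec> elts \<kappa>"
      using mem that ordinal_mem_subset[OF inaccessible_ordinal[OF assms(1)]] by blast
    ultimately show ?thesis
      using inaccessible_Pow_lesspoll[OF assms(1)] lesspoll_trans1 by blast
  qed
  then show ?case
    unfolding Vset_unfold[of \<beta>]
    by (rule regular_UN_lesspoll[OF reg cardinal_mem_lesspoll[OF card mem(2)]])
qed

text \<open>Uncountability enters here: if all elements of \<kappa> were finite, their cardinalities
  would embed \<kappa> into the natural numbers.\<close>

lemma inaccessible_infinite_mem:
  assumes "inaccessible \<kappa>"
  obtains \<alpha> where "\<alpha> \<in> elts \<kappa>" "infinite (elts \<alpha>)"
proof (rule ccontr)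
  assume "\<not> thesis"
  with that have fin: "\<forall>\<alpha>\<in>elts \<kappa>. finite (elts \<alpha>)" by blast
  note ord = inaccessible_ordinal[OF assms]
  have less: "card (elts \<alpha>) < card (elts \<beta>)" if "\<alpha> \<in> elts \<beta>" "\<beta> \<in> elts \<kappa>" for \<alpha> \<beta>
    using that fin ordinal_mem_subset[OF ordinal_mem[OF ord that(2)] that(1)] mem_irrefl[of \<alpha>]
    by (intro psubset_card_mono) auto
  have "inj_on (\<lambda>\<alpha>. card (elts \<alpha>)) (elts \<kappa>)"
    using less ordinal_linear ordinal_mem[OF ord] unfolding inj_on_def by (metis nat_neq_iff)
  then have "countable (elts \<kappa>)" by (rule countableI')
  with assms show False by (simp add: inaccessible_def)
qed

text \<open>The \<in>-minimal infinite element has no last element: for \<open>a\<close> in it,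
  minimality makes \<open>insert a (elts a)\<close> finite, so some further element lies above
  \<open>a\<close>.\<close>

lemma inaccessible_limit_mem:
  assumes "inaccessible \<kappa>"
  obtains \<omega> where "\<omega> \<in> elts \<kappa>" "elts \<omega> \<noteq> {}" "\<And>a. a \<in> elts \<omega> \<Longrightarrow> \<exists>b\<in>elts \<omega>. a \<in> elts b"
proof -
  note ord = inaccessible_ordinal[OF assms]
  obtain \<alpha> where "\<alpha> \<in> {\<alpha> \<in> elts \<kappa>. infinite (elts \<alpha>)}"
    using inaccessible_infinite_mem[OF assms] by blast
  then obtain \<omega> where \<omega>: "\<omega> \<in> elts \<kappa>" "infinite (elts \<omega>)"
    and min: "\<And>y. y \<in> elts \<omega> \<Longrightarrow> y \<notin> {\<alpha> \<in> elts \<kappa>. infinite (elts \<alpha>)}"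
    by (rule mem_minimal) blast
  show thesis
  proof (rule that[OF \<omega>(1)])
    show "elts \<omega> \<noteq> {}" using \<omega>(2) by auto
    fix a assume a: "a \<in> elts \<omega>"
    have "finite (insert a (elts a))"
      using min[OF a] a ordinal_mem_subset[OF ord \<omega>(1)] by auto
    with \<omega>(2) have "\<not> elts \<omega> \<subseteq> insert a (elts a)" by (meson finite_subset)
    then obtain b where "b \<in> elts \<omega>" "b \<notin> insert a (elts a)" by blast
    then show "\<exists>b\<in>elts \<omega>. a \<in> elts b"
      using ordinal_linear a ordinal_mem[OF ordinal_mem[OF ord \<omega>(1)]] by blast
  qed
qed

lemma universe_Vset:
  fixes \<kappa> :: "'v::zfc"
  assumes "inaccessible \<kappa>"
  shows "universe (Vset \<kappa>)"
  unfolding universe_def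
proof (intro conjI ballI allI impI)
  note ord = inaccessible_ordinal[OF assms]
  show "elts x \<subseteq> Vset \<kappa>" if "x \<in> Vset \<kappa>" for x
    using Vset_subset[OF ord that] .
  show "\<exists>y\<in>Vset \<kappa>. \<forall>z. elts z \<subseteq> elts x \<longrightarrow> z \<in> elts y" if "x \<in> Vset \<kappa>" for x
  proof -
    obtain \<beta> where \<beta>: "\<beta> \<in> elts \<kappa>" "elts x \<subseteq> Vset \<beta>" using \<open>x \<in> Vset \<kappa>\<close> Vset_iff by blast
    \<comment> \<open>An index beyond \<beta>: subsets of \<open>x\<close> are included in
      \<open>Vset \<beta>\<close>, hence elements of \<open>Vset \<gamma>\<close>.\<close>
    obtain \<gamma> where \<gamma>: "\<gamma> \<in> elts \<kappa>" "\<beta> \<in> elts \<gamma>" using inaccessible_limit[OF assms \<beta>(1)] .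
    obtain y where y: "elts y = Vset \<gamma>" using Vset_is_set by blast
    have "y \<in> Vset \<kappa>" using y \<gamma>(1) by (auto simp: Vset_iff)
    moreover have "z \<in> elts y" if "elts z \<subseteq> elts x" for z
      using that y \<gamma>(2) \<beta>(2) Vset_iff by blast
    ultimately show ?thesis by blast
  qed
  show "\<exists>w\<in>Vset \<kappa>. elts w \<noteq> {} \<and> (\<forall>a\<in>elts w. \<exists>b\<in>elts w. a \<in> elts b)"
  proof -
    \<comment> \<open>Every ordinal is included in the level with its own index, which places
      \<omega> in \<open>Vset \<kappa>\<close>.\<close>
    have sub: "elts \<alpha> \<subseteq> Vset \<alpha>" if "ordinal \<alpha>" for \<alpha> :: 'v
      using that
    proof (induction \<alpha> rule: mem_induct)
      case (mem \<alpha>)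
      then show ?case using ordinal_mem Vset_iff by blast
    qed
    obtain \<omega> where \<omega>: "\<omega> \<in> elts \<kappa>" "elts \<omega> \<noteq> {}" "\<And>a. a \<in> elts \<omega> \<Longrightarrow> \<exists>b\<in>elts \<omega>. a \<in> elts b"
      by (rule inaccessible_limit_mem[OF assms]) blast
    then show ?thesis using sub[OF ord] by blast
  qed
  fix x R assume x: "x \<in> Vset \<kappa>" and R: "\<forall>a\<in>elts x. \<exists>b\<in>Vset \<kappa>. R a b"
  \<comment> \<open>Choose a witness \<open>f a\<close> for each \<open>a\<close>, then the index
    \<open>g a\<close> of a level that includes it. Since \<open>x\<close> has fewer than \<kappa>
    elements, the indices are bounded by some \<gamma>, and \<open>Vset \<gamma>\<close> yields
    \<open>y\<close>.\<close>
  obtain f where f: "\<And>a. a \<in> elts x \<Longrightarrow> f a \<in> Vset \<kappa> \<and> R a (f a)" using R by metis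
  then obtain g where g: "\<And>a. a \<in> elts x \<Longrightarrow> g a \<in> elts \<kappa> \<and> elts (f a) \<subseteq> Vset (g a)"
    unfolding Vset_iff[of _ \<kappa>] by metis
  obtain \<beta> where \<beta>: "\<beta> \<in> elts \<kappa>" "elts x \<subseteq> Vset \<beta>" using x Vset_iff by blast
  have "g ` elts x \<prec> elts \<kappa>"
    using Vset_lesspoll[OF assms \<beta>(1)] image_lepoll subset_imp_lepoll[OF \<beta>(2)] lesspoll_trans1
    by blast
  then obtain \<gamma> where \<gamma>: "\<gamma> \<in> elts \<kappa>" "g ` elts x \<subseteq> elts \<gamma>"
    using inaccessible_bounded[OF assms, of "g ` elts x"] g by blast
  obtain y where y: "elts y = Vset \<gamma>" using Vset_is_set by blast
  have "elts (f a) \<subseteq> elts y" if "a \<in> elts x" for a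
  proof -
    have "Vset (g a) \<subseteq> Vset \<gamma>"
      using \<gamma> that ordinal_mem_subset[OF ordinal_mem[OF ord \<gamma>(1)]] by (intro Vset_mono) blast
    with g[OF that] y show ?thesis by blast
  qed
  moreover have "y \<in> Vset \<kappa>" using y \<gamma>(1) by (auto simp: Vset_iff)
  ultimately show "\<exists>y\<in>Vset \<kappa>. \<forall>a\<in>elts x. \<exists>b\<in>Vset \<kappa>. R a b \<and> elts b \<subseteq> elts y"
    using f by blast
qed

section \<open>Universes that are sets are levels at inaccessible cardinals\<close>

context
  fixes M :: "'v::zfc set"
  assumes univ: "universe M"
begin

lemma universe_trans: "x \<in> M \<Longrightarrow> y \<in> elts x \<Longrightarrow> y \<in> M"
  using univ by (auto simp: universe_def)

lemma universe_power:
  assumes "x \<in> M"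
  obtains y where "y \<in> M" "\<And>z. elts z \<subseteq> elts x \<Longrightarrow> z \<in> elts y"
proof -
  have "\<forall>x\<in>M. \<exists>y\<in>M. \<forall>z. elts z \<subseteq> elts x \<longrightarrow> z \<in> elts y"
    using univ by (simp add: universe_def)
  with assms that show thesis by blast
qed

lemma universe_infinity:
  obtains w where "w \<in> M" "elts w \<noteq> {}" "\<And>a. a \<in> elts w \<Longrightarrow> \<exists>b\<in>elts w. a \<in> elts b"
proof -
  have "\<exists>w\<in>M. elts w \<noteq> {} \<and> (\<forall>a\<in>elts w. \<exists>b\<in>elts w. a \<in> elts b)"
    using univ by (simp add: universe_def)
  with that show thesis by blast
qed

lemma universe_subset: "x \<in> M \<Longrightarrow> elts z \<subseteq> elts x \<Longrightarrow> z \<in> M"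
  using universe_power universe_trans by metis

lemma universe_subsetE:
  assumes "x \<in> M" "X \<subseteq> elts x"
  obtains z where "z \<in> M" "elts z = X"
  using subset_is_set[OF assms(2)] universe_subset[OF assms(1)] assms(2) by metis

lemma universe_collect:
  assumes "x \<in> M" "\<And>a. a \<in> elts x \<Longrightarrow> f a \<in> M"
  obtains y where "y \<in> M" "\<And>a. a \<in> elts x \<Longrightarrow> elts (f a) \<subseteq> elts y"
proof -
  have "(\<forall>a\<in>elts x. \<exists>b\<in>M. b = f a) \<longrightarrow> (\<exists>y\<in>M. \<forall>a\<in>elts x. \<exists>b\<in>M. b = f a \<and> elts b \<subseteq> elts y)"
    using univ assms(1) unfolding universe_def by (elim conjE) (drule bspec, assumption, erule spec)
  with assms(2) that show thesis by blast
qed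

text \<open>Collection only gives a \<open>y\<close> that includes each \<open>f a\<close>. The
  ordinals included in \<open>y\<close> form an ordinal \<gamma>, which has each \<open>f a\<close>
  as an element and lies in \<open>M\<close> as a subset of \<open>p\<close>.\<close>

lemma universe_bounded:
  assumes "x \<in> M" "\<And>a. a \<in> elts x \<Longrightarrow> f a \<in> M \<and> ordinal (f a)"
  obtains \<gamma> where "\<gamma> \<in> M" "ordinal \<gamma>" "\<And>a. a \<in> elts x \<Longrightarrow> f a \<in> elts \<gamma>"
proof -
  obtain y where y: "y \<in> M" "\<And>a. a \<in> elts x \<Longrightarrow> elts (f a) \<subseteq> elts y"
    using universe_collect[of x f] assms by blast
  obtain p where p: "p \<in> M" "\<And>z. elts z \<subseteq> elts y \<Longrightarrow> z \<in> elts p"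
    using universe_power[OF y(1)] by blast
  obtain \<gamma> where \<gamma>: "\<gamma> \<in> M" "elts \<gamma> = {z \<in> elts p. ordinal z \<and> elts z \<subseteq> elts y}"
    using universe_subsetE[OF p(1), of "{z \<in> elts p. ordinal z \<and> elts z \<subseteq> elts y}"] by blast
  have "ordinal \<gamma>"
    using p(2) ordinal_mem ordinal_mem_subset by (intro ordinalI) (simp add: \<gamma>(2), blast)
  then show thesis
    using that \<gamma> y(2) p(2) assms(2) by blast
qed

end

text \<open>The set \<delta> of ordinals in \<open>v\<close> is the required cardinal. Images in
  \<delta> of elements of \<open>v\<close> are bounded in \<delta> (\<open>bound\<close>), so
  elements of \<open>v\<close> are smaller than \<delta> (\<open>lt\<close>). Membership inductions
  then identify \<open>v\<close> with the level at \<delta>, and inaccessibility follows by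
  comparing sizes.\<close>

lemma universe_imp_Vset:
  fixes v :: "'v::zfc"
  assumes univ: "universe (elts v)"
  obtains \<delta> where "inaccessible \<delta>" "elts v = Vset \<delta>"
proof -
  obtain \<delta> where \<delta>: "elts \<delta> = {x \<in> elts v. ordinal x}"
    using separation[of v ordinal] by blast
  have ord: "ordinal \<delta>"
    using \<delta> ordinal_mem universe_trans[OF univ] by (intro ordinalI) auto
  have bound: "\<exists>\<gamma>\<in>elts \<delta>. f ` elts x \<subseteq> elts \<gamma>" if "x \<in> elts v" "f ` elts x \<subseteq> elts \<delta>" for x f
    using universe_bounded[OF univ that(1), of f] that(2) \<delta> by (auto simp: image_subset_iff) metis
  have ne: "elts \<delta> \<noteq> {}"
  proof -
    obtain x where "x \<in> elts v" by (rule universe_infinity[OF univ])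
    then obtain z where "z \<in> elts v" "elts z = {}"
      using universe_subsetE[OF univ, of x "{}"] by blast
    then show ?thesis using \<delta> by (auto simp: ordinal_def transitive_set_def)
  qed
  \<comment> \<open>Otherwise \<open>x\<close> would map onto \<delta>, and the bound of this image,
    an element of \<delta>, would include \<delta> and so contain itself.\<close>
  have lt: "elts x \<prec> elts \<delta>" if x: "x \<in> elts v" for x
  proof (rule ccontr)
    assume "\<not> elts x \<prec> elts \<delta>"
    then have "elts \<delta> \<lesssim> elts x" using not_lepoll_iff_lesspoll by blast
    then have "\<exists>f. f ` elts x = elts \<delta>"
      by (simp add: lepoll_def inj_on_iff_surj[OF ne])
    then obtain f where f: "f ` elts x = elts \<delta>" ..
    then obtain \<gamma> where "\<gamma> \<in> elts \<delta>" "elts \<delta> \<subseteq> elts \<gamma>" using bound[OF x, of f] by auto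
    then show False using mem_irrefl by blast
  qed
  have V: "\<exists>z\<in>elts v. elts z = Vset \<beta>" if "\<beta> \<in> elts \<delta>" for \<beta>
    using that
  proof (induction \<beta> rule: mem_induct)
    case (mem \<beta>)
    have "\<forall>\<xi>\<in>elts \<beta>. \<exists>z. z \<in> elts v \<and> elts z = Vset \<xi>"
      using mem ordinal_mem_subset[OF ord] by blast
    then obtain f where f: "\<And>\<xi>. \<xi> \<in> elts \<beta> \<Longrightarrow> f \<xi> \<in> elts v \<and> elts (f \<xi>) = Vset \<xi>"
      by metis
    obtain y where y: "y \<in> elts v" "\<And>\<xi>. \<xi> \<in> elts \<beta> \<Longrightarrow> elts (f \<xi>) \<subseteq> elts y"
      using universe_collect[OF univ, of \<beta> f] f mem(2) \<delta> by blast
    obtain p where p: "p \<in> elts v" "\<And>z. elts z \<subseteq> elts y \<Longrightarrow> z \<in> elts p"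
      using universe_power[OF univ y(1)] by blast
    have "Vset \<beta> \<subseteq> elts p"
      using f y(2) p(2) by (fastforce simp: Vset_iff)
    then show ?case using universe_subsetE[OF univ p(1)] by metis
  qed
  have "elts v \<subseteq> Vset \<delta>"
  proof
    fix x show "x \<in> elts v \<Longrightarrow> x \<in> Vset \<delta>"
    proof (induction x rule: mem_induct)
      case (mem x)
      then have "\<forall>a\<in>elts x. \<exists>\<beta>. \<beta> \<in> elts \<delta> \<and> elts a \<subseteq> Vset \<beta>"
        using universe_trans[OF univ] Vset_iff by blast
      then obtain f where f: "\<And>a. a \<in> elts x \<Longrightarrow> f a \<in> elts \<delta> \<and> elts a \<subseteq> Vset (f a)"
        by metis
      \<comment> \<open>The indices for the elements of \<open>x\<close> are bounded in \<delta>, so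
        a single level below \<delta> includes \<open>x\<close>.\<close>
      then obtain \<gamma> where "\<gamma> \<in> elts \<delta>" "f ` elts x \<subseteq> elts \<gamma>"
        using bound[OF mem(2), of f] by blast
      with f have "elts x \<subseteq> Vset \<gamma>" using Vset_iff by blast
      with \<open>\<gamma> \<in> elts \<delta>\<close> show ?case using Vset_iff by blast
    qed
  qed
  moreover have "Vset \<delta> \<subseteq> elts v"
    using V universe_subset[OF univ] by (metis Vset_iff subsetI)
  ultimately have eq: "elts v = Vset \<delta>" by blast
  have card: "cardinal \<delta>"
    using ord lt \<delta> by (auto simp: cardinal_def lesspoll_def)
  obtain w where w: "w \<in> elts v" "elts w \<noteq> {}" "\<And>a. a \<in> elts w \<Longrightarrow> \<exists>b\<in>elts w. a \<in> elts b"
    by (rule universe_infinity[OF univ]) blast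
  \<comment> \<open>A finite acyclic relation has a well-founded converse, so a finite
    \<open>w\<close> would have a \<in>-maximal element, contrary to the choice of
    \<open>w\<close>.\<close>
  have "infinite (elts w)"
  proof
    assume fin: "finite (elts w)"
    let ?r = "{(x, y). x \<in> elts y} \<inter> elts w \<times> elts w"
    have "finite ?r" using fin by blast
    moreover have "acyclic ?r" by (rule wf_acyclic[OF wf_subset[OF foundation]]) blast
    ultimately have wf: "wf (?r\<inverse>)" by (rule finite_acyclic_wf_converse)
    obtain a where "a \<in> elts w" using w(2) by blast
    with wf show False
    proof (rule wfE_min)
      fix m assume m: "m \<in> elts w" "\<And>b. (b, m) \<in> ?r\<inverse> \<Longrightarrow> b \<notin> elts w"
      obtain b where b: "b \<in> elts w" "m \<in> elts b" using w(3)[OF m(1)] by blast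
      then have "(b, m) \<in> ?r\<inverse>" using m(1) by simp
      with b(1) show False using m(2) by blast
    qed
  qed
  \<comment> \<open>A countable \<delta> would embed into the infinite \<open>w\<close>, which
    \<open>lt\<close> makes strictly smaller than \<delta>.\<close>
  have unc: "uncountable (elts \<delta>)"
  proof
    assume "countable (elts \<delta>)"
    then have "elts \<delta> \<lesssim> (UNIV :: nat set)" by (auto simp: countable_def lepoll_def)
    also have "(UNIV :: nat set) \<lesssim> elts w" using \<open>infinite (elts w)\<close> by (simp add: infinite_le_lepoll)
    finally show False using lt[OF w(1)] not_lepoll_iff_lesspoll by blast
  qed
  have "regular \<delta>"
    unfolding regular_def
  proof (intro conjI allI impI)
    show "cardinal \<delta>" by fact
    show "infinite (elts \<delta>)" using unc countable_finite by blast
    fix X assume X: "X \<subseteq> elts \<delta>" and cof: "\<forall>\<alpha>\<in>elts \<delta>. \<exists>\<beta>\<in>X. \<alpha> = \<beta> \<or> \<alpha> \<in> elts \<beta>"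
    \<comment> \<open>A smaller \<open>X\<close> is the image of some \<beta> in \<delta>, hence
      included in some \<gamma> in \<delta>; then no element of \<open>X\<close> reaches
      \<gamma>.\<close>
    show "X \<approx> elts \<delta>"
    proof (rule ccontr)
      assume "\<not> X \<approx> elts \<delta>"
      then have "X \<prec> elts \<delta>" using X by (simp add: lesspoll_def subset_imp_lepoll)
      then obtain \<beta> where \<beta>: "\<beta> \<in> elts \<delta>" "X \<approx> elts \<beta>" using lesspoll_ordinalE[OF ord] by blast
      then obtain f where "f ` elts \<beta> = X"
        by (metis eqpoll_sym eqpoll_def bij_betw_def)
      then obtain \<gamma> where "\<gamma> \<in> elts \<delta>" "X \<subseteq> elts \<gamma>"
        using bound[of \<beta> f] \<beta>(1) X \<delta> by blast
      then show False using cof mem_irrefl mem_asym by blast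
    qed
  qed
  moreover have "strong_limit \<delta>"
    unfolding strong_limit_def
  proof (intro conjI ballI)
    show "cardinal \<delta>" by fact
    fix \<alpha> assume "\<alpha> \<in> elts \<delta>"
    then obtain p where p: "p \<in> elts v" "\<And>z. elts z \<subseteq> elts \<alpha> \<Longrightarrow> z \<in> elts p"
      using universe_power[OF univ] \<delta> by blast
    \<comment> \<open>As \<open>p\<close> contains every subset of \<alpha>, it is at least as large
      as the power set, and \<open>lt\<close> applies to \<open>p\<close>.\<close>
    have "Pow (elts \<alpha>) \<subseteq> elts ` elts p"
      using p(2) subset_is_set by (metis PowD image_eqI subsetI)
    then have "Pow (elts \<alpha>) \<lesssim> elts p" by (rule subset_image_lepoll)
    then show "Pow (elts \<alpha>) \<prec> elts \<delta>" using lt[OF p(1)] lesspoll_trans1 by blast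
  qed
  ultimately have "inaccessible \<delta>" using unc by (simp add: inaccessible_def)
  with eq that show thesis by blast
qed

section \<open>Definability\<close>

lemma sat_cong:
  assumes "\<forall>i\<in>free_vars \<phi>. e i = e' i" "\<forall>j\<in>free_set_vars \<phi>. E j = E' j"
  shows "sat M e E \<phi> \<longleftrightarrow> sat M e' E' \<phi>"
  using assms
proof (induction \<phi> arbitrary: e e' E E')
  case (Neg \<phi>)
  then show ?case by simp
next
  case (Conj \<phi> \<psi>)
  then have "sat M e E \<phi> = sat M e' E' \<phi>" "sat M e E \<psi> = sat M e' E' \<psi>"
    by (simp_all del: sat.simps)
  then show ?case by simp
next
  case (All i \<phi>)
  then have "sat M (e(i := x)) E \<phi> = sat M (e'(i := x)) E' \<phi>" for x
    by (intro All.IH) auto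
  then show ?case by simp
next
  case (AllSet j \<phi>)
  then have "sat M e (E(j := X)) \<phi> = sat M e' (E'(j := X)) \<phi>" for X
    by (intro AllSet.IH) auto
  then show ?case by simp
qed auto

text \<open>The value of a sentence does not depend on the assignment, so \<open>e\<close> and
  \<open>E\<close> may even leave \<open>M\<close>. Nonemptiness provides an assignment within
  \<open>M\<close> to which \<open>models\<close> can be applied.\<close>

lemma models_sentence:
  fixes M :: "'v::zfc set"
  assumes "second_order_sentence \<sigma>" "M \<noteq> {}"
  shows "M \<Turnstile> \<sigma> \<longleftrightarrow> sat M e E \<sigma>"
proof -
  have inv: "sat M e' E' \<sigma> \<longleftrightarrow> sat M e E \<sigma>" for e' E'
    using assms(1) by (intro sat_cong) (auto simp: second_order_sentence_def)
  obtain a where "a \<in> M" using assms(2) by blast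
  show ?thesis
  proof
    assume "M \<Turnstile> \<sigma>"
    then have "sat M (\<lambda>_. a) (\<lambda>_. {}) \<sigma>" using \<open>a \<in> M\<close> by (auto simp: models_def)
    then show "sat M e E \<sigma>" using inv by blast
  next
    assume "sat M e E \<sigma>"
    then show "M \<Turnstile> \<sigma>" unfolding models_def using inv by blast
  qed
qed

lemma first_order_free_set_vars: "first_order \<phi> \<Longrightarrow> free_set_vars \<phi> = {}"
  by (induction \<phi>) auto

definition Imp :: "fm \<Rightarrow> fm \<Rightarrow> fm" where "Imp \<phi> \<psi> = Neg (Conj \<phi> (Neg \<psi>))"
definition Or :: "fm \<Rightarrow> fm \<Rightarrow> fm" where "Or \<phi> \<psi> = Neg (Conj (Neg \<phi>) (Neg \<psi>))"
definition Iff :: "fm \<Rightarrow> fm \<Rightarrow> fm" where "Iff \<phi> \<psi> = Conj (Imp \<phi> \<psi>) (Imp \<psi> \<phi>)"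
definition Exi :: "nat \<Rightarrow> fm \<Rightarrow> fm" where "Exi i \<phi> = Neg (All i (Neg \<phi>))"

lemma sat_connectives [simp]:
  "sat M e E (Imp \<phi> \<psi>) \<longleftrightarrow> (sat M e E \<phi> \<longrightarrow> sat M e E \<psi>)"
  "sat M e E (Or \<phi> \<psi>) \<longleftrightarrow> sat M e E \<phi> \<or> sat M e E \<psi>"
  "sat M e E (Iff \<phi> \<psi>) \<longleftrightarrow> (sat M e E \<phi> \<longleftrightarrow> sat M e E \<psi>)"
  "sat M e E (Exi i \<phi>) \<longleftrightarrow> (\<exists>x\<in>M. sat M (e(i := x)) E \<phi>)"
  by (auto simp: Imp_def Or_def Iff_def Exi_def)

lemma free_vars_connectives [simp]:
  "free_vars (Imp \<phi> \<psi>) = free_vars \<phi> \<union> free_vars \<psi>"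
  "free_vars (Or \<phi> \<psi>) = free_vars \<phi> \<union> free_vars \<psi>"
  "free_vars (Iff \<phi> \<psi>) = free_vars \<phi> \<union> free_vars \<psi>"
  "free_vars (Exi i \<phi>) = free_vars \<phi> - {i}"
  by (auto simp: Imp_def Or_def Iff_def Exi_def)

lemma free_set_vars_connectives [simp]:
  "free_set_vars (Imp \<phi> \<psi>) = free_set_vars \<phi> \<union> free_set_vars \<psi>"
  by (simp add: Imp_def)

lemma first_order_connectives [simp]:
  "first_order (Imp \<phi> \<psi>) \<longleftrightarrow> first_order \<phi> \<and> first_order \<psi>"
  "first_order (Or \<phi> \<psi>) \<longleftrightarrow> first_order \<phi> \<and> first_order \<psi>"
  "first_order (Iff \<phi> \<psi>) \<longleftrightarrow> first_order \<phi> \<and> first_order \<psi>"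
  "first_order (Exi i \<phi>) \<longleftrightarrow> first_order \<phi>"
  by (auto simp: Imp_def Or_def Iff_def Exi_def)

text \<open>
  Variable \<open>0\<close> holds the set to which quantifiers are relativized, odd variables hold the values of
  first-order variables, and the remaining even ones sets coding the values of second-order variables.
\<close>

fun relativize :: "fm \<Rightarrow> fm" where
  "relativize (Mem i j) = Mem (2 * i + 1) (2 * j + 1)"
| "relativize (Eq i j) = Eq (2 * i + 1) (2 * j + 1)"
| "relativize (In i j) = Mem (2 * i + 1) (2 * j + 2)"
| "relativize (Neg \<phi>) = Neg (relativize \<phi>)"
| "relativize (Conj \<phi> \<psi>) = Conj (relativize \<phi>) (relativize \<psi>)"
| "relativize (All i \<phi>) = All (2 * i + 1) (Imp (Mem (2 * i + 1) 0) (relativize \<phi>))"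
| "relativize (AllSet j \<phi>) =
     All (2 * j + 2) (Imp (All 1 (Imp (Mem 1 (2 * j + 2)) (Mem 1 0))) (relativize \<phi>))"

lemma first_order_relativize: "first_order (relativize \<phi>)"
  by (induction \<phi>) auto

text \<open>For a sentence only variable \<open>0\<close> can remain free, so one quantifier over it
  closes the formula.\<close>

lemma free_vars_relativize:
  "free_vars (relativize \<phi>) \<subseteq>
     insert 0 ((\<lambda>i. 2 * i + 1) ` free_vars \<phi> \<union> (\<lambda>j. 2 * j + 2) ` free_set_vars \<phi>)"
  by (induction \<phi>) auto

text \<open>By transitivity the elements of \<open>v\<close> lie in \<open>M\<close>, and by closure
  under subsets every HOL subset of \<open>elts v\<close> is the extension of an element of
  \<open>M\<close>. Guarded first-order quantifiers over \<open>M\<close> thus have the range of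
  both kinds of quantifier over \<open>v\<close>. The subset guard reuses variable \<open>1\<close>,
  whose binding ends before the relativized body.\<close>

lemma sat_relativize:
  assumes univ: "universe M" and "e 0 = v" "v \<in> M"
  shows "sat M e E (relativize \<phi>) \<longleftrightarrow>
         sat (elts v) (\<lambda>i. e (2 * i + 1)) (\<lambda>j. elts (e (2 * j + 2))) \<phi>"
  using assms(2)
proof (induction \<phi> arbitrary: e)
  case (All i \<phi>)
  have upd: "(\<lambda>k. (e(2 * i + 1 := x)) (2 * k + 1)) = (\<lambda>k. e (2 * k + 1))(i := x)"
    "(\<lambda>k. elts ((e(2 * i + 1 := x)) (2 * k + 2))) = (\<lambda>k. elts (e (2 * k + 2)))" for x
    by (auto simp: fun_eq_iff Suc_double_not_eq_double double_not_eq_Suc_double)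
  have "sat M (e(2 * i + 1 := x)) E (relativize \<phi>) \<longleftrightarrow>
      sat (elts v) ((\<lambda>k. e (2 * k + 1))(i := x)) (\<lambda>k. elts (e (2 * k + 2))) \<phi>" for x
  proof -
    have "(e(2 * i + 1 := x)) 0 = v" using All.prems by simp
    from All.IH[of "e(2 * i + 1 := x)", OF this] show ?thesis by (simp only: upd)
  qed
  then show ?case using All.prems universe_trans[OF univ \<open>v \<in> M\<close>] by auto
next
  case (AllSet j \<phi>)
  have upd: "(\<lambda>k. (e(2 * j + 2 := x)) (2 * k + 1)) = (\<lambda>k. e (2 * k + 1))"
    "(\<lambda>k. elts ((e(2 * j + 2 := x)) (2 * k + 2))) = (\<lambda>k. elts (e (2 * k + 2)))(j := elts x)" for x
    by (auto simp: fun_eq_iff Suc_double_not_eq_double double_not_eq_Suc_double)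
  have IH: "sat M (e(2 * j + 2 := x)) E (relativize \<phi>) \<longleftrightarrow>
      sat (elts v) (\<lambda>k. e (2 * k + 1)) ((\<lambda>k. elts (e (2 * k + 2)))(j := elts x)) \<phi>" for x
  proof -
    have "(e(2 * j + 2 := x)) 0 = v" using AllSet.prems by simp
    from AllSet.IH[of "e(2 * j + 2 := x)", OF this] show ?thesis by (simp only: upd)
  qed
  have sub: "(\<forall>z\<in>M. z \<in> elts x \<longrightarrow> z \<in> elts v) \<longleftrightarrow> elts x \<subseteq> elts v" if "x \<in> M" for x
    using universe_trans[OF univ that] by blast
  have "sat M e E (relativize (AllSet j \<phi>)) \<longleftrightarrow>
      (\<forall>x\<in>M. elts x \<subseteq> elts v \<longrightarrow> sat M (e(2 * j + 2 := x)) E (relativize \<phi>))"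
    using AllSet.prems sub by simp
  also have "\<dots> \<longleftrightarrow> (\<forall>X. X \<subseteq> elts v \<longrightarrow>
      sat (elts v) (\<lambda>k. e (2 * k + 1)) ((\<lambda>k. elts (e (2 * k + 2)))(j := X)) \<phi>)"
    unfolding IH
  proof (intro iffI allI impI ballI)
    fix X assume all: "\<forall>x\<in>M. elts x \<subseteq> elts v \<longrightarrow>
        sat (elts v) (\<lambda>k. e (2 * k + 1)) ((\<lambda>k. elts (e (2 * k + 2)))(j := elts x)) \<phi>"
      and X: "X \<subseteq> elts v"
    obtain x where "x \<in> M" "elts x = X" using universe_subsetE[OF univ \<open>v \<in> M\<close> X] .
    with all X show "sat (elts v) (\<lambda>k. e (2 * k + 1)) ((\<lambda>k. elts (e (2 * k + 2)))(j := X)) \<phi>"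
      by blast
  qed simp
  finally show ?case by simp
qed auto

section \<open>Kuratowski pairs and a first-order definition of universes\<close>

definition is_pair :: "'v::zfc \<Rightarrow> 'v \<Rightarrow> 'v \<Rightarrow> bool" where
  "is_pair p a b \<longleftrightarrow> (\<forall>z. z \<in> elts p \<longleftrightarrow> elts z = {a} \<or> elts z = {a, b})"

lemma is_pair_exists:
  fixes a :: "'v::zfc"
  shows "\<exists>p. is_pair p a b"
proof -
  obtain s d :: 'v where s: "elts s = {a}" and d: "elts d = {a, b}"
    using pairing[of a a] pairing[of a b] by auto
  obtain p where "elts p = {s, d}" using pairing by blast
  then have "is_pair p a b"
    unfolding is_pair_def using s d extensionality by (metis insert_iff singletonD)
  then show ?thesis ..
qed

lemma is_pair_inject:
  fixes a :: "'v::zfc"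
  assumes "is_pair p a b" "is_pair p a' b'"
  shows "a = a' \<and> b = b'"
proof -
  obtain s d s' d' :: 'v where
    sd: "elts s = {a}" "elts d = {a, b}" "elts s' = {a'}" "elts d' = {a', b'}"
    using pairing[of a a] pairing[of a b] pairing[of a' a'] pairing[of a' b'] by auto
  have p: "z \<in> elts p \<longleftrightarrow> elts z = {a} \<or> elts z = {a, b}" for z
    using assms(1) by (simp add: is_pair_def)
  have p': "z \<in> elts p \<longleftrightarrow> elts z = {a'} \<or> elts z = {a', b'}" for z
    using assms(2) by (simp add: is_pair_def)
  have "{a} = {a'} \<or> {a} = {a', b'}" "{a, b} = {a'} \<or> {a, b} = {a', b'}"
    "{a', b'} = {a} \<or> {a', b'} = {a, b}"
    using p[of s] p'[of s] p[of d] p'[of d] p[of d'] p'[of d'] sd by simp_all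
  then show ?thesis by (auto simp: doubleton_eq_iff)
qed

text \<open>The Kuratowski pair of the values of variables \<open>3\<close> and \<open>4\<close> belongs to the value of \<open>2\<close>.\<close>

definition pair_in_fm :: fm where
  "pair_in_fm = Exi 6 (Conj (Mem 6 2) (All 7 (Iff (Mem 7 6)
     (Or (All 8 (Iff (Mem 8 7) (Eq 8 3))) (All 8 (Iff (Mem 8 7) (Or (Eq 8 3) (Eq 8 4))))))))"

text \<open>Sets with extension \<open>{e 3}\<close> or \<open>{e 3, e 4}\<close> are subsets of
  \<open>v\<close> and hence lie in \<open>M\<close>; with transitivity of \<open>M\<close>,
  bounding the quantifiers by \<open>M\<close> changes nothing.\<close>

lemma sat_pair_in_fm:
  assumes univ: "universe M" and "v \<in> M" "e 3 \<in> elts v" "e 4 \<in> elts v" "e 2 \<in> M"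
  shows "sat M e E pair_in_fm \<longleftrightarrow> (\<exists>p\<in>elts (e 2). is_pair p (e 3) (e 4))"
proof -
  have ab: "e 3 \<in> M" "e 4 \<in> M" using assms universe_trans[OF univ] by blast+
  have single: "(\<forall>y\<in>M. y \<in> elts z \<longleftrightarrow> y = e 3) \<longleftrightarrow> elts z = {e 3}" if "z \<in> M" for z
    using universe_trans[OF univ that] ab by blast
  have double: "(\<forall>y\<in>M. y \<in> elts z \<longleftrightarrow> y = e 3 \<or> y = e 4) \<longleftrightarrow> elts z = {e 3, e 4}" if "z \<in> M" for z
    using universe_trans[OF univ that] ab by blast
  have small: "z \<in> M" if "elts z = {e 3} \<or> elts z = {e 3, e 4}" for z
    using universe_subset[OF univ \<open>v \<in> M\<close>] that assms(3,4) by auto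
  have pair: "(\<forall>z\<in>M. z \<in> elts p \<longleftrightarrow> elts z = {e 3} \<or> elts z = {e 3, e 4}) \<longleftrightarrow>
      is_pair p (e 3) (e 4)" if "p \<in> M" for p
    unfolding is_pair_def using universe_trans[OF univ that] small by blast
  have "sat M e E pair_in_fm \<longleftrightarrow> (\<exists>p\<in>M. p \<in> elts (e 2) \<and> (\<forall>z\<in>M. z \<in> elts p \<longleftrightarrow>
      (\<forall>y\<in>M. y \<in> elts z \<longleftrightarrow> y = e 3) \<or> (\<forall>y\<in>M. y \<in> elts z \<longleftrightarrow> y = e 3 \<or> y = e 4)))"
    by (simp add: pair_in_fm_def)
  also have "\<dots> \<longleftrightarrow> (\<exists>p\<in>M. p \<in> elts (e 2) \<and> is_pair p (e 3) (e 4))"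
    by (simp only: single double pair cong: ball_cong bex_cong conj_cong)
  finally show ?thesis using universe_trans[OF univ \<open>e 2 \<in> M\<close>] by blast
qed

text \<open>In this and the next three formulas variable \<open>0\<close> holds the candidate
  universe, an element of the structure.\<close>

definition transitive_fm :: fm where
  "transitive_fm = All 1 (Imp (Mem 1 0) (All 2 (Imp (Mem 2 1) (Mem 2 0))))"

definition power_fm :: fm where
  "power_fm = All 1 (Imp (Mem 1 0) (Exi 2 (Conj (Mem 2 0)
     (All 3 (Imp (All 4 (Imp (Mem 4 3) (Mem 4 1))) (Mem 3 2))))))"

definition infinity_fm :: fm where
  "infinity_fm = Exi 1 (Conj (Mem 1 0) (Conj (Exi 2 (Mem 2 1))
     (All 2 (Imp (Mem 2 1) (Exi 3 (Conj (Mem 3 1) (Mem 2 3)))))))"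

text \<open>Variable \<open>2\<close> holds a set of Kuratowski pairs in place of the relation
  \<open>R\<close> of \<open>universe\<close>. It ranges over the whole structure, because the graph
  of a relation on the candidate universe need not be an element of the candidate.\<close>

definition collection_fm :: fm where
  "collection_fm = All 1 (Imp (Mem 1 0) (All 2 (Imp
     (All 3 (Imp (Mem 3 1) (Exi 4 (Conj (Mem 4 0) pair_in_fm))))
     (Exi 5 (Conj (Mem 5 0) (All 3 (Imp (Mem 3 1)
        (Exi 4 (Conj (Mem 4 0) (Conj pair_in_fm (All 6 (Imp (Mem 6 4) (Mem 6 5)))))))))))))"

definition universe_fm :: fm where
  "universe_fm = Conj transitive_fm (Conj power_fm (Conj infinity_fm collection_fm))"

lemma first_order_universe_fm: "first_order universe_fm"
  by (simp add: universe_fm_def transitive_fm_def power_fm_def infinity_fm_def collection_fm_def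
      pair_in_fm_def)

lemma free_vars_universe_fm: "free_vars universe_fm = {0}"
  by (auto simp: universe_fm_def transitive_fm_def power_fm_def infinity_fm_def collection_fm_def
      pair_in_fm_def)

context
  fixes M :: "'v::zfc set" and e :: "nat \<Rightarrow> 'v" and v :: 'v
  assumes univ: "universe M" and e0: "e 0 = v" and v: "v \<in> M"
begin

lemma sat_transitive_fm: "sat M e E transitive_fm \<longleftrightarrow> (\<forall>x\<in>elts v. elts x \<subseteq> elts v)"
proof -
  have "sat M e E transitive_fm \<longleftrightarrow> (\<forall>x\<in>M. x \<in> elts v \<longrightarrow> (\<forall>y\<in>M. y \<in> elts x \<longrightarrow> y \<in> elts v))"
    by (simp add: transitive_fm_def e0)
  then show ?thesis using universe_trans[OF univ] v by blast
qed

lemma sat_power_fm: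
  "sat M e E power_fm \<longleftrightarrow>
     (\<forall>x\<in>elts v. \<exists>y\<in>elts v. \<forall>z. elts z \<subseteq> elts x \<longrightarrow> z \<in> elts y)"
proof -
  have "sat M e E power_fm \<longleftrightarrow> (\<forall>x\<in>M. x \<in> elts v \<longrightarrow> (\<exists>y\<in>M. y \<in> elts v \<and>
      (\<forall>z\<in>M. (\<forall>u\<in>M. u \<in> elts z \<longrightarrow> u \<in> elts x) \<longrightarrow> z \<in> elts y)))"
    by (simp add: power_fm_def e0)
  also have "\<dots> \<longleftrightarrow> (\<forall>x\<in>elts v. \<exists>y\<in>elts v. \<forall>z\<in>M. (\<forall>u\<in>M. u \<in> elts z \<longrightarrow> u \<in> elts x) \<longrightarrow> z \<in> elts y)"
    using universe_trans[OF univ v] by blast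
  \<comment> \<open>Every subset of \<open>x\<close> lies in \<open>M\<close>, so bounding
    \<open>z\<close> by \<open>M\<close> loses nothing.\<close>
  also have "\<dots> \<longleftrightarrow> (\<forall>x\<in>elts v. \<exists>y\<in>elts v. \<forall>z. elts z \<subseteq> elts x \<longrightarrow> z \<in> elts y)"
  proof (rule ball_cong[OF refl], rule bex_cong[OF refl])
    fix x y assume "x \<in> elts v"
    then have "x \<in> M" using universe_trans[OF univ v] by blast
    then show "(\<forall>z\<in>M. (\<forall>u\<in>M. u \<in> elts z \<longrightarrow> u \<in> elts x) \<longrightarrow> z \<in> elts y) \<longleftrightarrow>
        (\<forall>z. elts z \<subseteq> elts x \<longrightarrow> z \<in> elts y)"
      using universe_trans[OF univ] universe_subset[OF univ] by (meson subset_iff)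
  qed
  finally show ?thesis .
qed

lemma sat_infinity_fm:
  "sat M e E infinity_fm \<longleftrightarrow>
     (\<exists>w\<in>elts v. elts w \<noteq> {} \<and> (\<forall>a\<in>elts w. \<exists>b\<in>elts w. a \<in> elts b))"
proof -
  have "sat M e E infinity_fm \<longleftrightarrow> (\<exists>w\<in>M. w \<in> elts v \<and> (\<exists>a\<in>M. a \<in> elts w) \<and>
      (\<forall>a\<in>M. a \<in> elts w \<longrightarrow> (\<exists>b\<in>M. b \<in> elts w \<and> a \<in> elts b)))"
    by (simp add: infinity_fm_def e0)
  also have "\<dots> \<longleftrightarrow> (\<exists>w\<in>elts v. elts w \<noteq> {} \<and> (\<forall>a\<in>elts w. \<exists>b\<in>elts w. a \<in> elts b))"
    using universe_trans[OF univ] v by (smt (verit, best) ex_in_conv)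
  finally show ?thesis .
qed

text \<open>Transitivity of \<open>v\<close> places \<open>a\<close> and \<open>b\<close> in
  \<open>v\<close>, as \<open>sat_pair_in_fm\<close> requires. Only the part of \<open>R\<close>
  between \<open>elts x\<close> and \<open>elts v\<close> matters, and a set of pairs in
  \<open>M\<close> codes it, so quantifying over sets in \<open>M\<close> reaches all
  relations.\<close>

lemma sat_collection_fm:
  assumes trans: "\<forall>x\<in>elts v. elts x \<subseteq> elts v"
  shows "sat M e E collection_fm \<longleftrightarrow>
     (\<forall>x\<in>elts v. \<forall>R. (\<forall>a\<in>elts x. \<exists>b\<in>elts v. R a b) \<longrightarrow>
        (\<exists>y\<in>elts v. \<forall>a\<in>elts x. \<exists>b\<in>elts v. R a b \<and> elts b \<subseteq> elts y))"
    (is "_ \<longleftrightarrow> (\<forall>x\<in>elts v. \<forall>R. ?collect x R)")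
proof -
  note vM = universe_trans[OF univ v]
  let ?R = "\<lambda>r a b. \<exists>p\<in>elts r. is_pair p a b"
  let ?e = "\<lambda>x r. e(1 := x, 2 := r)"
  have prem: "sat M (?e x r) E (All 3 (Imp (Mem 3 1) (Exi 4 (Conj (Mem 4 0) pair_in_fm)))) \<longleftrightarrow>
      (\<forall>a\<in>elts x. \<exists>b\<in>elts v. ?R r a b)" if "x \<in> elts v" "r \<in> M" for x r
  proof -
    have "sat M (?e x r) E (All 3 (Imp (Mem 3 1) (Exi 4 (Conj (Mem 4 0) pair_in_fm)))) \<longleftrightarrow>
      (\<forall>a\<in>M. a \<in> elts x \<longrightarrow> (\<exists>b\<in>M. b \<in> elts v \<and> sat M ((?e x r)(3 := a, 4 := b)) E pair_in_fm))"
      by (simp add: e0)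
    moreover have "sat M ((?e x r)(3 := a, 4 := b)) E pair_in_fm \<longleftrightarrow> ?R r a b"
      if "a \<in> elts x" "b \<in> elts v" for a b
      using sat_pair_in_fm[OF univ v, of "(?e x r)(3 := a, 4 := b)"] that \<open>x \<in> elts v\<close> \<open>r \<in> M\<close> trans
      by auto
    ultimately show ?thesis using vM trans \<open>x \<in> elts v\<close> by (smt (verit, best) subsetD)
  qed
  have concl: "sat M (?e x r) E (Exi 5 (Conj (Mem 5 0) (All 3 (Imp (Mem 3 1)
        (Exi 4 (Conj (Mem 4 0) (Conj pair_in_fm (All 6 (Imp (Mem 6 4) (Mem 6 5)))))))))) \<longleftrightarrow>
      (\<exists>y\<in>elts v. \<forall>a\<in>elts x. \<exists>b\<in>elts v. ?R r a b \<and> elts b \<subseteq> elts y)" (is "?L \<longleftrightarrow> _")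
    if "x \<in> elts v" "r \<in> M" for x r
  proof -
    have pair: "sat M ((?e x r)(5 := y, 3 := a, 4 := b)) E pair_in_fm \<longleftrightarrow> ?R r a b"
      if "a \<in> elts x" "b \<in> elts v" for a b y
      using sat_pair_in_fm[OF univ v, of "(?e x r)(5 := y, 3 := a, 4 := b)"] that
        \<open>x \<in> elts v\<close> \<open>r \<in> M\<close> trans
      by auto
    have sub: "(\<forall>c\<in>M. c \<in> elts b \<longrightarrow> c \<in> elts y) \<longleftrightarrow> elts b \<subseteq> elts y" if "b \<in> elts v" for b y
      using universe_trans[OF univ vM[OF that]] by blast
    have xM: "a \<in> M" if "a \<in> elts x" for a using that vM trans \<open>x \<in> elts v\<close> by blast
    have "?L \<longleftrightarrow> (\<exists>y\<in>M. y \<in> elts v \<and> (\<forall>a\<in>M. a \<in> elts x \<longrightarrow> (\<exists>b\<in>M. b \<in> elts v \<and>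
        sat M ((?e x r)(5 := y, 3 := a, 4 := b)) E pair_in_fm \<and> (\<forall>c\<in>M. c \<in> elts b \<longrightarrow> c \<in> elts y))))"
      by (simp add: e0)
    also have "\<dots> \<longleftrightarrow> (\<exists>y\<in>M. y \<in> elts v \<and> (\<forall>a\<in>M. a \<in> elts x \<longrightarrow> (\<exists>b\<in>M. b \<in> elts v \<and>
        ?R r a b \<and> elts b \<subseteq> elts y)))"
      by (simp only: pair sub cong: bex_cong ball_cong conj_cong imp_cong)
    also have "\<dots> \<longleftrightarrow> (\<exists>y\<in>elts v. \<forall>a\<in>elts x. \<exists>b\<in>elts v. ?R r a b \<and> elts b \<subseteq> elts y)"
      using vM xM by meson
    finally show ?thesis .
  qed
  have "sat M e E collection_fm \<longleftrightarrow> (\<forall>x\<in>M. x \<in> elts v \<longrightarrow> (\<forall>r\<in>M. ?collect x (?R r)))"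
    unfolding collection_fm_def using prem concl by (simp add: e0 del: sat.simps(6)) (simp add: e0)
  also have "\<dots> \<longleftrightarrow> (\<forall>x\<in>elts v. \<forall>r\<in>M. ?collect x (?R r))" using vM by blast
  also have "\<dots> \<longleftrightarrow> (\<forall>x\<in>elts v. \<forall>R. ?collect x R)"
  proof (rule ball_cong[OF refl], rule iffI[OF allI])
    fix x R assume x: "x \<in> elts v" and all: "\<forall>r\<in>M. ?collect x (?R r)"
    \<comment> \<open>Two power sets above \<open>v\<close>: for \<open>a\<close>, \<open>b\<close>
      in \<open>v\<close> the sets \<open>{a}\<close> and \<open>{a, b}\<close> are elements of
      \<open>q\<close>, so their pair is an element of \<open>q'\<close>, and separation from
      \<open>q'\<close> gives the code \<open>r\<close>.\<close>
    obtain q where q: "q \<in> M" "\<And>z. elts z \<subseteq> elts v \<Longrightarrow> z \<in> elts q"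
      using universe_power[OF univ v] by blast
    obtain q' where q': "q' \<in> M" "\<And>z. elts z \<subseteq> elts q \<Longrightarrow> z \<in> elts q'"
      using universe_power[OF univ q(1)] by blast
    obtain r where r: "r \<in> M" "elts r = {p \<in> elts q'. \<exists>a b. is_pair p a b \<and> R a b}"
      using universe_subsetE[OF univ q'(1), of "{p \<in> elts q'. \<exists>a b. is_pair p a b \<and> R a b}"] by blast
    have "?R r a b \<longleftrightarrow> R a b" if "a \<in> elts x" "b \<in> elts v" for a b
    proof
      assume "?R r a b"
      then show "R a b" using r(2) is_pair_inject by blast
    next
      assume "R a b"
      obtain p where p: "is_pair p a b" using is_pair_exists by blast
      have "elts p \<subseteq> elts q"
        using p q(2) that x trans unfolding is_pair_def by (auto simp: subset_iff)
      then show "?R r a b" using p r(2) q'(2) \<open>R a b\<close> by blast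
    qed
    with bspec[OF all r(1)] show "?collect x R" by (smt (verit, best))
  next
    fix x assume "\<forall>R. ?collect x R"
    then show "\<forall>r\<in>M. ?collect x (?R r)" by (intro ballI) (erule spec)
  qed
  finally show ?thesis .
qed

text \<open>\<open>conj_cong\<close> hands the first conjunct, transitivity, to the collection
  clause as an assumption.\<close>

lemma sat_universe_fm: "sat M e E universe_fm \<longleftrightarrow> universe (elts v)"
  unfolding universe_fm_def universe_def sat.simps(5) sat_transitive_fm sat_power_fm sat_infinity_fm
  using sat_collection_fm by (intro conj_cong refl) assumption

end

section \<open>The categorical sentence\<close>

definition least_fm :: "fm \<Rightarrow> fm" where
  "least_fm \<sigma> = Conj \<sigma> (All 0 (Imp universe_fm (Neg (relativize \<sigma>))))"

lemma second_order_sentence_least_fm: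
  assumes "second_order_sentence \<sigma>"
  shows "second_order_sentence (least_fm \<sigma>)"
  using assms free_vars_relativize[of \<sigma>] first_order_free_set_vars[OF first_order_relativize, of \<sigma>]
    first_order_free_set_vars[OF first_order_universe_fm]
  by (auto simp: second_order_sentence_def least_fm_def free_vars_universe_fm)

lemma first_order_sentence_least_fm:
  assumes "first_order_sentence \<sigma>"
  shows "first_order_sentence (least_fm \<sigma>)"
  using assms free_vars_relativize[of \<sigma>] first_order_free_set_vars[of \<sigma>]
  by (auto simp: first_order_sentence_def least_fm_def free_vars_universe_fm
      first_order_universe_fm first_order_relativize)

text \<open>For the forward direction: if \<delta> were not in \<mu>, linearity and monotonicity
  would give \<open>Vset \<mu> \<subseteq> Vset \<delta>\<close>, and \<open>v\<close> would be an
  element of itself.\<close>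

lemma Vset_mem_Vset:
  assumes "ordinal \<delta>" "ordinal \<mu>" "elts v = Vset \<delta>"
  shows "v \<in> Vset \<mu> \<longleftrightarrow> \<delta> \<in> elts \<mu>"
proof
  assume "v \<in> Vset \<mu>"
  then have "\<not> Vset \<mu> \<subseteq> Vset \<delta>" using assms(3) mem_irrefl by blast
  then have "\<not> elts \<mu> \<subseteq> elts \<delta>" using Vset_mono by blast
  then show "\<delta> \<in> elts \<mu>"
    using ordinal_linear[OF assms(1,2)] ordinal_mem_subset[OF assms(1)] by blast
next
  assume "\<delta> \<in> elts \<mu>"
  with assms(3) show "v \<in> Vset \<mu>" using Vset_iff by blast
qed

lemma Vset_inaccessible_nonempty: "inaccessible \<mu> \<Longrightarrow> Vset \<mu> \<noteq> {}"
  using universe_infinity[OF universe_Vset] by blast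

text \<open>The universes among the elements of \<open>Vset \<mu>\<close> are exactly the levels at
  inaccessible \<delta> in \<mu>, so the quantifier over variable \<open>0\<close> becomes one over
  \<delta>.\<close>

lemma models_least_fm:
  fixes \<mu> :: "'v::zfc"
  assumes "inaccessible \<mu>" "second_order_sentence \<sigma>"
  shows "Vset \<mu> \<Turnstile> least_fm \<sigma> \<longleftrightarrow>
     Vset \<mu> \<Turnstile> \<sigma> \<and> (\<forall>\<delta>\<in>elts \<mu>. inaccessible \<delta> \<longrightarrow> \<not> Vset \<delta> \<Turnstile> \<sigma>)"
proof -
  \<comment> \<open>Any assignments serve, since \<sigma> and \<open>least_fm \<sigma>\<close> are
    sentences.\<close>
  define e :: "nat \<Rightarrow> 'v" where "e = undefined"
  define E :: "nat \<Rightarrow> 'v set" where "E = undefined"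
  note univ = universe_Vset[OF assms(1)]
  note ord = inaccessible_ordinal
  have inst: "sat (Vset \<mu>) (e(0 := v)) E (Imp universe_fm (Neg (relativize \<sigma>))) \<longleftrightarrow>
      (universe (elts v) \<longrightarrow> \<not> elts v \<Turnstile> \<sigma>)" if v: "v \<in> Vset \<mu>" for v
  proof -
    have "elts v \<noteq> {}" if "universe (elts v)" using universe_infinity[OF that] by blast
    then show ?thesis
      using sat_universe_fm[OF univ _ v, of "e(0 := v)" E] sat_relativize[OF univ _ v, of "e(0 := v)" E \<sigma>]
        models_sentence[OF assms(2), of "elts v"] by simp
  qed
  have "Vset \<mu> \<Turnstile> least_fm \<sigma> \<longleftrightarrow> sat (Vset \<mu>) e E (least_fm \<sigma>)"
    by (intro models_sentence second_order_sentence_least_fm Vset_inaccessible_nonempty assms)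
  also have "\<dots> \<longleftrightarrow> Vset \<mu> \<Turnstile> \<sigma> \<and> (\<forall>v\<in>Vset \<mu>. universe (elts v) \<longrightarrow> \<not> elts v \<Turnstile> \<sigma>)"
    unfolding least_fm_def sat.simps(5) sat.simps(6)
      models_sentence[OF assms(2) Vset_inaccessible_nonempty[OF assms(1)], of e E]
    using inst by (simp del: sat.simps)
  also have "(\<forall>v\<in>Vset \<mu>. universe (elts v) \<longrightarrow> \<not> elts v \<Turnstile> \<sigma>) \<longleftrightarrow>
      (\<forall>\<delta>\<in>elts \<mu>. inaccessible \<delta> \<longrightarrow> \<not> Vset \<delta> \<Turnstile> \<sigma>)"
  proof (intro iffI ballI impI)
    fix \<delta> assume all: "\<forall>v\<in>Vset \<mu>. universe (elts v) \<longrightarrow> \<not> elts v \<Turnstile> \<sigma>"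
      and \<delta>: "\<delta> \<in> elts \<mu>" "inaccessible \<delta>"
    obtain v where v: "elts v = Vset \<delta>" using Vset_is_set by blast
    have "v \<in> Vset \<mu>" using Vset_mem_Vset[OF ord ord v] \<delta> assms(1) by blast
    then show "\<not> Vset \<delta> \<Turnstile> \<sigma>" using all universe_Vset[OF \<delta>(2)] v by metis
  next
    fix v assume all: "\<forall>\<delta>\<in>elts \<mu>. inaccessible \<delta> \<longrightarrow> \<not> Vset \<delta> \<Turnstile> \<sigma>"
      and v: "v \<in> Vset \<mu>" "universe (elts v)"
    obtain \<delta> where \<delta>: "inaccessible \<delta>" "elts v = Vset \<delta>" using universe_imp_Vset[OF v(2)] .
    then have "\<delta> \<in> elts \<mu>" using Vset_mem_Vset[OF ord ord \<delta>(2)] v(1) assms(1) by blast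
    with all \<delta> show "\<not> elts v \<Turnstile> \<sigma>" by simp
  qed
  finally show ?thesis .
qed

lemma least_fm_categorical:
  assumes "inaccessible \<kappa>" "second_order_sentence \<sigma>" "Vset \<kappa> \<Turnstile> \<sigma>"
    and "\<not> (\<exists>\<delta>\<in>elts \<kappa>. inaccessible \<delta> \<and> Vset \<delta> \<Turnstile> \<sigma>)"
  shows "Vset \<kappa> \<Turnstile> least_fm \<sigma>"
    and "\<And>\<mu>. inaccessible \<mu> \<Longrightarrow> \<mu> \<noteq> \<kappa> \<Longrightarrow> \<not> Vset \<mu> \<Turnstile> least_fm \<sigma>"
proof -
  show "Vset \<kappa> \<Turnstile> least_fm \<sigma>" using assms models_least_fm by blast
  fix \<mu> assume \<mu>: "inaccessible \<mu>" "\<mu> \<noteq> \<kappa>"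
  then have "\<mu> \<in> elts \<kappa> \<or> \<kappa> \<in> elts \<mu>"
    using ordinal_linear inaccessible_ordinal assms(1) by blast
  then show "\<not> Vset \<mu> \<Turnstile> least_fm \<sigma>"
    unfolding models_least_fm[OF \<mu>(1) assms(2)] using assms \<mu> by blast
qed

theorem theorem4:
  fixes \<kappa> :: "'v::zfc"
  assumes "inaccessible \<kappa>"
  shows "(\<not> first_order_sententially_categorical \<kappa> \<longrightarrow>
            (\<forall>\<sigma>. first_order_sentence \<sigma> \<and> Vset \<kappa> \<Turnstile> \<sigma> \<longrightarrow>
               (\<exists>\<delta>\<in>elts \<kappa>. inaccessible \<delta> \<and> Vset \<delta> \<Turnstile> \<sigma>))) \<and>
         (\<not> second_order_sententially_categorical \<kappa> \<longrightarrow>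
            (\<forall>\<sigma>. second_order_sentence \<sigma> \<and> Vset \<kappa> \<Turnstile> \<sigma> \<longrightarrow>
               (\<exists>\<delta>\<in>elts \<kappa>. inaccessible \<delta> \<and> Vset \<delta> \<Turnstile> \<sigma>)))"
proof (intro conjI impI allI; elim conjE; rule ccontr)
  fix \<sigma> assume not: "\<not> first_order_sententially_categorical \<kappa>"
    and \<sigma>: "first_order_sentence \<sigma>" "Vset \<kappa> \<Turnstile> \<sigma>"
    and none: "\<not> (\<exists>\<delta>\<in>elts \<kappa>. inaccessible \<delta> \<and> Vset \<delta> \<Turnstile> \<sigma>)"
  \<comment> \<open>A first-order sentence has no set variables, so the second-order argument covers
    it; \<open>least_fm \<sigma>\<close> is again first-order because relativized formulas and
    \<open>universe_fm\<close> are.\<close>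
  have "second_order_sentence \<sigma>"
    using \<sigma>(1) first_order_free_set_vars
    by (auto simp: first_order_sentence_def second_order_sentence_def)
  from least_fm_categorical[OF assms this \<sigma>(2) none] show False
    using not first_order_sentence_least_fm[OF \<sigma>(1)] assms
    unfolding first_order_sententially_categorical_def by blast
next
  fix \<sigma> assume not: "\<not> second_order_sententially_categorical \<kappa>"
    and \<sigma>: "second_order_sentence \<sigma>" "Vset \<kappa> \<Turnstile> \<sigma>"
    and none: "\<not> (\<exists>\<delta>\<in>elts \<kappa>. inaccessible \<delta> \<and> Vset \<delta> \<Turnstile> \<sigma>)"
  from least_fm_categorical[OF assms \<sigma> none] show False
    using not second_order_sentence_least_fm[OF \<sigma>(1)] assms
    unfolding second_order_sententially_categorical_def by blast
qed

end
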